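(* Let $I$ be an index set and let $F:[0,+\infty]^I\to[0,+\infty]$ be a function. The following statements are equivalent: (1) $F\in\mathsf{se}\mathscr{P}(\mathsf{P}_+^I,\mathsf{P}_+)$; (2) $F\in\mathscr{P}(\mathsf{P}_+^I,\mathsf{P}_+)$ and $F^{-1}(0)=\{0_I\}$; (3) $F\in\mathsf{sy}\mathscr{P}(\mathsf{P}_+^I,\mathsf{P}_+)$, $F$ is isotone and $F^{-1}(0)=\{0_I\}$; (4) $F$ is a metric modular aggregation function on products; (5) $F$ is isotone, subadditive and $F^{-1}(0)=\{0_I\}$; (6) $F$ is a quasi-metric modular aggregation function on products.
   Context: A quasi-metric modular on a nonempty set $X$ is a function $w:(0,+\infty)\times X\times X\to[0,+\infty]$ such that for all $x,y,z\in X$ and $t,s>0$: $w(t,x,x)=0$; $w(t+s,x,y)\le w(t,x,z)+w(s,z,y)$; and, for all $x,y\in X$, one has $w(t,x,y)=w(t,y,x)=0$ for every $t>0$ if and only if $x=y$. It is a metric modular if moreover $w(t,x,y)=w(t,y,x)$ for all $x,y\in X$, $t>0$. The pair $(X,w)$ is then a (quasi-)metric modular space. $F:[0,+\infty]^I\to[0,+\infty]$ is a quasi-metric (resp. metric) modular aggregation function on products if for every family $\{(X_i,w_i):i\in I\}$ of quasi-metric (resp. metric) modular spaces the function $(t,x,y)\mapsto F\big((w_i(t,x_i,y_i))_{i\in I}\big)$ is a quasi-metric (resp. metric) modular on $\prod_{i\in I}X_i$. Quantale means commutative integral quantale: a complete lattice $(\mathscr{V},\preceq)$ with an associative commutative operation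 $\ast$ distributing over arbitrary suprema, with a unit $1_{\mathscr V}$ equal to the top element. $\mathsf{P}_+=([0,+\infty],\le^{op},+)$, where $x\le^{op}y$ iff $y\le x$ (unit $0$); $\mathsf{P}_+^I$ is the product quantale on $[0,+\infty]^I$ with componentwise order and operation, with unit $0_I=(0)_{i\in I}$. For a quantale $(\mathscr{V},\preceq,\ast)$, a $\mathscr{V}$-category is a pair $(X,a)$ with $X$ a nonempty set and $a:X\times X\to\mathscr{V}$ such that $1_{\mathscr V}\preceq a(x,x)$ and $a(x,z)\ast a(z,y)\preceq a(x,y)$ for all $x,y,z\in X$. It is separated if $1_{\mathscr V}\preceq a(x,y)$ and $1_{\mathscr V}\preceq a(y,x)$ imply $x=y$, and symmetric if $a(x,y)=a(y,x)$ for all $x,y$. A map $F:\mathscr{V}\to\mathscr{W}$ between quantales is preserving (resp. separately preserving, symmetrically preserving) if $(X,F\circ a)$ is a $\mathscr{W}$-category (resp. separated $\mathscr{W}$-category, symmetric $\mathscr{W}$-category) whenever $(X,a)$ is a $\mathscr{V}$-category (resp. separated $\mathscr{V}$-category, symmetric $\mathscr{V}$-category). The sets of such maps are denoted $\mathscr{P}(\mathscr{V},\mathscr{W})$, $\mathsf{se}\mathscr{P}(\mathscr{V},\mathscr{W})$, $\mathsf{sy}\mathscr{P}(\mathscr{V},\mathscr{W})$, respectively. Isotone means: $x\le y$ componentwise implies $F(x)\le F(y)$. Subadditive means $F(x+y)\le F(x)+F(y)$ for all $x,y\in[0,+\infty]^I$. *)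

theory Defs
  imports
    "HOL-Algebra.Complete_Lattice"
    "HOL-Library.Extended_Nonnegative_Real"
    "HOL-Library.Infinite_Typeclass"
begin

section \<open>Quantales\<close>

record 'v quantale = "'v gorder" +
  qmult :: "'v \<Rightarrow> 'v \<Rightarrow> 'v"  (infixl \<open>\<star>\<index>\<close> 70)
  qone :: 'v

locale comm_integral_quantale = complete_lattice V for V :: "'v quantale" (structure) +
  assumes qmult_closed: "\<lbrakk>x \<in> carrier V; y \<in> carrier V\<rbrakk> \<Longrightarrow> x \<star> y \<in> carrier V"
    and qmult_assoc:
      "\<lbrakk>x \<in> carrier V; y \<in> carrier V; z \<in> carrier V\<rbrakk> \<Longrightarrow> (x \<star> y) \<star> z = x \<star> (y \<star> z)"
    and qmult_comm: "\<lbrakk>x \<in> carrier V; y \<in> carrier V\<rbrakk> \<Longrightarrow> x \<star> y = y \<star> x"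
    and qone_closed: "qone V \<in> carrier V"
    and qmult_one: "x \<in> carrier V \<Longrightarrow> x \<star> qone V = x"
    and qone_top: "qone V = \<top>"
    and qmult_sup: "\<lbrakk>x \<in> carrier V; A \<subseteq> carrier V\<rbrakk> \<Longrightarrow> x \<star> \<Squnion>A = \<Squnion>((\<lambda>a. x \<star> a) ` A)"

definition P_plus :: "ennreal quantale" where
  "P_plus = \<lparr>carrier = UNIV, eq = (=), le = (\<lambda>x y. y \<le> x), qmult = (+), qone = 0\<rparr>"

text \<open>
  The power of a quantale is carried by the extensional functions on the index set \<open>I\<close>. Taking
  \<open>I\<close> to be a set rather than a whole type keeps the empty index set as an instance.
\<close>

definition quantale_power :: "'v quantale \<Rightarrow> 'i set \<Rightarrow> ('i \<Rightarrow> 'v) quantale" where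
  "quantale_power V I =
    \<lparr>carrier = I \<rightarrow>\<^sub>E carrier V,
     eq = (=),
     le = (\<lambda>x y. \<forall>i\<in>I. x i \<sqsubseteq>\<^bsub>V\<^esub> y i),
     qmult = (\<lambda>x y. \<lambda>i\<in>I. x i \<star>\<^bsub>V\<^esub> y i),
     qone = (\<lambda>i\<in>I. qone V)\<rparr>"

lemma P_plus_simps [simp]:
  "carrier P_plus = UNIV" "eq P_plus = (=)" "le P_plus x y \<longleftrightarrow> y \<le> x"
  "qmult P_plus = (+)" "qone P_plus = 0"
  by (simp_all add: P_plus_def)

lemma quantale_power_simps [simp]:
  "carrier (quantale_power V I) = I \<rightarrow>\<^sub>E carrier V"
  "eq (quantale_power V I) = (=)"
  "le (quantale_power V I) x y \<longleftrightarrow> (\<forall>i\<in>I. le V (x i) (y i))"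
  "qmult (quantale_power V I) x y = (\<lambda>i\<in>I. qmult V (x i) (y i))"
  "qone (quantale_power V I) = (\<lambda>i\<in>I. qone V)"
  by (simp_all add: quantale_power_def)

lemma P_plus_partial_order: "partial_order P_plus"
  by unfold_locales auto

lemma P_plus_least_Inf: "least P_plus (Inf A) (Upper P_plus A)"
  by (auto simp: least_def Upper_def intro: Inf_lower Inf_greatest)

lemma P_plus_complete_lattice: "complete_lattice P_plus"
proof -
  interpret partial_order P_plus by (rule P_plus_partial_order)
  show ?thesis
  proof
    fix A :: "ennreal set"
    show "\<exists>s. least P_plus s (Upper P_plus A)" using P_plus_least_Inf by blast
    have "greatest P_plus (Sup A) (Lower P_plus A)"
      by (auto simp: greatest_def Lower_def intro: Sup_upper Sup_least)
    then show "\<exists>s. greatest P_plus s (Lower P_plus A)" by blast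
  qed
qed

lemma P_plus_sup: "\<Squnion>\<^bsub>P_plus\<^esub>A = Inf A"
proof -
  interpret complete_lattice P_plus by (rule P_plus_complete_lattice)
  show ?thesis using least_unique[OF sup_lub P_plus_least_Inf] by simp
qed

lemma P_plus_quantale: "comm_integral_quantale P_plus"
proof -
  interpret complete_lattice P_plus by (rule P_plus_complete_lattice)
  show ?thesis
  proof
    have "greatest P_plus 0 (carrier P_plus)" by (auto simp: greatest_def)
    then show "qone P_plus = \<top>\<^bsub>P_plus\<^esub>"
      using greatest_unique top_greatest by simp
  next
    fix x :: ennreal and A :: "ennreal set"
    have "x + Inf A = (INF a\<in>A. x + a)"
    proof (cases "A = {}")
      case False
      then show ?thesis
        using continuous_at_Inf_mono[of "\<lambda>a. x + a" A]
          continuous_add[of "at_right (Inf A)", of "\<lambda>_. x" "\<lambda>a. a"]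
        by (auto simp: mono_def)
    qed simp
    then show "x \<star>\<^bsub>P_plus\<^esub> \<Squnion>\<^bsub>P_plus\<^esub>A = \<Squnion>\<^bsub>P_plus\<^esub>((\<lambda>a. x \<star>\<^bsub>P_plus\<^esub> a) ` A)"
      by (simp add: P_plus_sup)
  qed (simp_all add: ac_simps)
qed

lemma quantale_power_quantale:
  assumes "comm_integral_quantale V"
  shows "comm_integral_quantale (quantale_power V I)"
proof -
  interpret V: comm_integral_quantale V by (rule assms)
  let ?W = "quantale_power V I"
  have mem: "a i \<in> carrier V" if "A \<subseteq> carrier ?W" "a \<in> A" "i \<in> I" for A a i
    using that by (auto simp: PiE_iff)
  have po: "partial_order ?W"
  proof
    fix x y assume "le ?W x y" "le ?W y x" "x \<in> carrier ?W" "y \<in> carrier ?W"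
    then show "eq ?W x y"
      by (simp, intro PiE_ext[where k=I and s="\<lambda>_. carrier V"])
         (auto simp: PiE_iff intro!: V.weak_le_antisym[unfolded V.eq_is_equal])
  next
    fix x y z assume "le ?W x y" "le ?W y z" "x \<in> carrier ?W" "y \<in> carrier ?W" "z \<in> carrier ?W"
    then show "le ?W x z" by (simp add: PiE_iff) (meson V.le_trans)
  qed (auto simp: PiE_iff)
  have lub: "least ?W (\<lambda>i\<in>I. \<Squnion>\<^bsub>V\<^esub>((\<lambda>a. a i) ` A)) (Upper ?W A)" if A: "A \<subseteq> carrier ?W" for A
    unfolding least_def
  proof (intro conjI ballI)
    have sub: "(\<lambda>a. a i) ` A \<subseteq> carrier V" if "i \<in> I" for i using mem[OF A _ that] by auto
    show "Upper ?W A \<subseteq> carrier ?W" by (rule Upper_closed)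
    show "(\<lambda>i\<in>I. \<Squnion>\<^bsub>V\<^esub>((\<lambda>a. a i) ` A)) \<in> Upper ?W A"
      using sub by (auto simp: Upper_def intro!: V.sup_upper V.sup_closed)
    fix y assume y: "y \<in> Upper ?W A"
    then have "y \<in> carrier ?W" "\<forall>a\<in>A. le ?W a y" using A by (auto simp: Upper_def)
    then show "le ?W (\<lambda>i\<in>I. \<Squnion>\<^bsub>V\<^esub>((\<lambda>a. a i) ` A)) y"
      by (simp, intro ballI V.sup_least) (use sub in \<open>auto simp: PiE_iff\<close>)
  qed
  have glb: "greatest ?W (\<lambda>i\<in>I. \<Sqinter>\<^bsub>V\<^esub>((\<lambda>a. a i) ` A)) (Lower ?W A)" if A: "A \<subseteq> carrier ?W" for A
    unfolding greatest_def
  proof (intro conjI ballI)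
    have sub: "(\<lambda>a. a i) ` A \<subseteq> carrier V" if "i \<in> I" for i using mem[OF A _ that] by auto
    show "Lower ?W A \<subseteq> carrier ?W" by (rule Lower_closed)
    show "(\<lambda>i\<in>I. \<Sqinter>\<^bsub>V\<^esub>((\<lambda>a. a i) ` A)) \<in> Lower ?W A"
      using sub by (auto simp: Lower_def intro!: V.inf_lower V.inf_closed)
    fix y assume y: "y \<in> Lower ?W A"
    then have "y \<in> carrier ?W" "\<forall>a\<in>A. le ?W y a" using A by (auto simp: Lower_def)
    then show "le ?W y (\<lambda>i\<in>I. \<Sqinter>\<^bsub>V\<^esub>((\<lambda>a. a i) ` A))"
      by (simp, intro ballI V.inf_greatest) (use sub in \<open>auto simp: PiE_iff\<close>)
  qed
  interpret W: partial_order ?W by (rule po)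
  have cl: "complete_lattice ?W" using lub glb by unfold_locales blast+
  interpret W: complete_lattice ?W by (rule cl)
  have sup: "\<Squnion>\<^bsub>?W\<^esub>A = (\<lambda>i\<in>I. \<Squnion>\<^bsub>V\<^esub>((\<lambda>a. a i) ` A))" if "A \<subseteq> carrier ?W" for A
    using W.least_unique[OF W.sup_lub[OF that] lub[OF that]] .
  show ?thesis
  proof
    have "greatest ?W (qone ?W) (carrier ?W)"
      by (auto simp: greatest_def V.qone_closed V.qone_top PiE_iff)
    then show "qone ?W = \<top>\<^bsub>?W\<^esub>" using W.greatest_unique W.top_greatest by blast
  next
    fix x A assume x: "x \<in> carrier ?W" and A: "A \<subseteq> carrier ?W"
    have im: "(\<lambda>a. x \<star>\<^bsub>?W\<^esub> a) ` A \<subseteq> carrier ?W"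
      using x mem[OF A] by (auto simp: PiE_iff V.qmult_closed)
    have "x i \<star>\<^bsub>V\<^esub> \<Squnion>\<^bsub>V\<^esub>((\<lambda>a. a i) ` A) = \<Squnion>\<^bsub>V\<^esub>((\<lambda>a. a i) ` ((\<lambda>a. x \<star>\<^bsub>?W\<^esub> a) ` A))"
      if i: "i \<in> I" for i
    proof -
      have "x i \<in> carrier V" "(\<lambda>a. a i) ` A \<subseteq> carrier V"
        using x i mem[OF A] by (auto simp: PiE_iff)
      then show ?thesis using i by (simp add: V.qmult_sup image_image)
    qed
    then show "x \<star>\<^bsub>?W\<^esub> \<Squnion>\<^bsub>?W\<^esub>A = \<Squnion>\<^bsub>?W\<^esub>((\<lambda>a. x \<star>\<^bsub>?W\<^esub> a) ` A)"
      unfolding sup[OF A] sup[OF im] by (simp cong: restrict_cong)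
  next
    fix x assume x: "x \<in> carrier ?W"
    then show "x \<star>\<^bsub>?W\<^esub> qone ?W = x"
      by (auto simp: PiE_iff V.qmult_one extensional_def)
  next
    fix x y assume "x \<in> carrier ?W" "y \<in> carrier ?W"
    then show "x \<star>\<^bsub>?W\<^esub> y = y \<star>\<^bsub>?W\<^esub> x"
      by (auto simp: PiE_iff intro!: restrict_ext V.qmult_comm)
  qed (auto simp: PiE_iff V.qmult_closed V.qone_closed V.qmult_assoc intro!: restrict_ext)
qed


section \<open>Categories enriched over a quantale\<close>

definition vcategory :: "'v quantale \<Rightarrow> 'x set \<Rightarrow> ('x \<Rightarrow> 'x \<Rightarrow> 'v) \<Rightarrow> bool" where
  "vcategory V X a \<longleftrightarrow>
    X \<noteq> {} \<and>
    (\<forall>x\<in>X. \<forall>y\<in>X. a x y \<in> carrier V) \<and>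
    (\<forall>x\<in>X. qone V \<sqsubseteq>\<^bsub>V\<^esub> a x x) \<and>
    (\<forall>x\<in>X. \<forall>y\<in>X. \<forall>z\<in>X. a x z \<star>\<^bsub>V\<^esub> a z y \<sqsubseteq>\<^bsub>V\<^esub> a x y)"

definition separated_vcategory :: "'v quantale \<Rightarrow> 'x set \<Rightarrow> ('x \<Rightarrow> 'x \<Rightarrow> 'v) \<Rightarrow> bool" where
  "separated_vcategory V X a \<longleftrightarrow>
    vcategory V X a \<and>
    (\<forall>x\<in>X. \<forall>y\<in>X. qone V \<sqsubseteq>\<^bsub>V\<^esub> a x y \<and> qone V \<sqsubseteq>\<^bsub>V\<^esub> a y x \<longrightarrow> x = y)"

definition symmetric_vcategory :: "'v quantale \<Rightarrow> 'x set \<Rightarrow> ('x \<Rightarrow> 'x \<Rightarrow> 'v) \<Rightarrow> bool" where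
  "symmetric_vcategory V X a \<longleftrightarrow> vcategory V X a \<and> (\<forall>x\<in>X. \<forall>y\<in>X. a x y = a y x)"

text \<open>
  A HOL definition cannot quantify over all types, so the ambient type \<open>'x\<close> of the underlying sets
  is a parameter. A set of any type embeds into an infinite type, and structures transport along
  bijections of the underlying sets; hence letting \<open>'x\<close> range over all infinite types accounts for
  all underlying sets, finite ones included. On a type with too few elements the notions below
  would be too weak.
\<close>

definition preserving_maps ::
    "'x itself \<Rightarrow> 'v quantale \<Rightarrow> 'w quantale \<Rightarrow> ('v \<Rightarrow> 'w) set" where
  "preserving_maps _ V W =
    {F \<in> carrier V \<rightarrow> carrier W.
      \<forall>(X :: 'x set) a. vcategory V X a \<longrightarrow> vcategory W X (\<lambda>x y. F (a x y))}"

definition separately_preserving_maps ::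
    "'x itself \<Rightarrow> 'v quantale \<Rightarrow> 'w quantale \<Rightarrow> ('v \<Rightarrow> 'w) set" where
  "separately_preserving_maps _ V W =
    {F \<in> carrier V \<rightarrow> carrier W.
      \<forall>(X :: 'x set) a.
        separated_vcategory V X a \<longrightarrow> separated_vcategory W X (\<lambda>x y. F (a x y))}"

definition symmetrically_preserving_maps ::
    "'x itself \<Rightarrow> 'v quantale \<Rightarrow> 'w quantale \<Rightarrow> ('v \<Rightarrow> 'w) set" where
  "symmetrically_preserving_maps _ V W =
    {F \<in> carrier V \<rightarrow> carrier W.
      \<forall>(X :: 'x set) a.
        symmetric_vcategory V X a \<longrightarrow> symmetric_vcategory W X (\<lambda>x y. F (a x y))}"


section \<open>Modulars and their aggregation on products\<close>

text \<open>Only the values \<open>w t x y\<close> with \<open>t > 0\<close> and \<open>x, y \<in> X\<close> are relevant.\<close>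

definition quasi_metric_modular :: "'x set \<Rightarrow> (real \<Rightarrow> 'x \<Rightarrow> 'x \<Rightarrow> ennreal) \<Rightarrow> bool" where
  "quasi_metric_modular X w \<longleftrightarrow>
    X \<noteq> {} \<and>
    (\<forall>t>0. \<forall>x\<in>X. w t x x = 0) \<and>
    (\<forall>t>0. \<forall>s>0. \<forall>x\<in>X. \<forall>y\<in>X. \<forall>z\<in>X. w (t + s) x y \<le> w t x z + w s z y) \<and>
    (\<forall>x\<in>X. \<forall>y\<in>X. (\<forall>t>0. w t x y = 0 \<and> w t y x = 0) \<longleftrightarrow> x = y)"

definition metric_modular :: "'x set \<Rightarrow> (real \<Rightarrow> 'x \<Rightarrow> 'x \<Rightarrow> ennreal) \<Rightarrow> bool" where
  "metric_modular X w \<longleftrightarrow>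
    quasi_metric_modular X w \<and> (\<forall>t>0. \<forall>x\<in>X. \<forall>y\<in>X. w t x y = w t y x)"

definition product_modular ::
    "'i set \<Rightarrow> (('i \<Rightarrow> ennreal) \<Rightarrow> ennreal) \<Rightarrow> ('i \<Rightarrow> real \<Rightarrow> 'x \<Rightarrow> 'x \<Rightarrow> ennreal) \<Rightarrow>
     real \<Rightarrow> ('i \<Rightarrow> 'x) \<Rightarrow> ('i \<Rightarrow> 'x) \<Rightarrow> ennreal" where
  "product_modular I F w t x y = F (\<lambda>i\<in>I. w i t (x i) (y i))"

text \<open>As above, \<open>'x\<close> is the ambient type, here of all the factors \<open>X i\<close>.\<close>

definition quasi_metric_modular_aggregation ::
    "'x itself \<Rightarrow> 'i set \<Rightarrow> (('i \<Rightarrow> ennreal) \<Rightarrow> ennreal) \<Rightarrow> bool" where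
  "quasi_metric_modular_aggregation _ I F \<longleftrightarrow>
    (\<forall>(X :: 'i \<Rightarrow> 'x set) w.
      (\<forall>i\<in>I. quasi_metric_modular (X i) (w i)) \<longrightarrow>
      quasi_metric_modular (\<Pi>\<^sub>E i\<in>I. X i) (product_modular I F w))"

definition metric_modular_aggregation ::
    "'x itself \<Rightarrow> 'i set \<Rightarrow> (('i \<Rightarrow> ennreal) \<Rightarrow> ennreal) \<Rightarrow> bool" where
  "metric_modular_aggregation _ I F \<longleftrightarrow>
    (\<forall>(X :: 'i \<Rightarrow> 'x set) w.
      (\<forall>i\<in>I. metric_modular (X i) (w i)) \<longrightarrow>
      metric_modular (\<Pi>\<^sub>E i\<in>I. X i) (product_modular I F w))"


section \<open>Properties of functions on powers of the extended half-line\<close>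

definition isotone_on_power :: "'i set \<Rightarrow> (('i \<Rightarrow> ennreal) \<Rightarrow> ennreal) \<Rightarrow> bool" where
  "isotone_on_power I F \<longleftrightarrow>
    (\<forall>x \<in> I \<rightarrow>\<^sub>E UNIV. \<forall>y \<in> I \<rightarrow>\<^sub>E UNIV. (\<forall>i\<in>I. x i \<le> y i) \<longrightarrow> F x \<le> F y)"

definition subadditive_on_power :: "'i set \<Rightarrow> (('i \<Rightarrow> ennreal) \<Rightarrow> ennreal) \<Rightarrow> bool" where
  "subadditive_on_power I F \<longleftrightarrow>
    (\<forall>x \<in> I \<rightarrow>\<^sub>E UNIV. \<forall>y \<in> I \<rightarrow>\<^sub>E UNIV. F (\<lambda>i\<in>I. x i + y i) \<le> F x + F y)"

definition vanishes_only_at_zero :: "'i set \<Rightarrow> (('i \<Rightarrow> ennreal) \<Rightarrow> ennreal) \<Rightarrow> bool" where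
  "vanishes_only_at_zero I F \<longleftrightarrow> {x \<in> I \<rightarrow>\<^sub>E UNIV. F x = 0} = {\<lambda>i\<in>I. 0}"

definition all_equivalent :: "bool list \<Rightarrow> bool" where
  "all_equivalent Ps \<longleftrightarrow> (\<forall>P \<in> set Ps. \<forall>Q \<in> set Ps. P \<longleftrightarrow> Q)"

end

theory Submission
  imports Defs
begin

text \<open>
  Every one of the conditions amounts to: \<open>F\<close> vanishes only at zero, and
  \<open>p \<le> q + r\<close> implies \<open>F p \<le> F q + F r\<close>. Three-point structures whose distances are \<open>q\<close>,
  \<open>r\<close> and \<open>p\<close> produce the inequality, and two-point structures show that \<open>F\<close> vanishes only at
  zero. For modulars the parameter \<open>t\<close> takes over the role of asymmetry: a symmetric modular
  that is infinite before, and zero after, a threshold time realises any \<open>p \<le> q + r\<close>, so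
  metric modulars suffice.
\<close>

section \<open>Distinct points of an infinite type, for the test structures\<close>

lemma infinite_type_two_points:
  obtains a b :: "'a::infinite" where "a \<noteq> b"
  using infinite_arbitrarily_large[OF infinite_UNIV, of 2] by (auto simp: card_2_iff)

lemma infinite_type_three_points:
  obtains a b c :: "'a::infinite" where "a \<noteq> b" "b \<noteq> c" "a \<noteq> c"
  using infinite_arbitrarily_large[OF infinite_UNIV, of 3] by (auto simp: card_3_iff)

section \<open>The triangle condition and isotone subadditive functions\<close>

text \<open>Only one of the three inequalities of a triangle is imposed on the triple, so this is
  preservation of asymmetric triangle triplets.\<close>

definition triangular_on_power :: "'i set \<Rightarrow> (('i \<Rightarrow> ennreal) \<Rightarrow> ennreal) \<Rightarrow> bool" where
  "triangular_on_power I F \<longleftrightarrow>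
    (\<forall>p \<in> I \<rightarrow>\<^sub>E UNIV. \<forall>q \<in> I \<rightarrow>\<^sub>E UNIV. \<forall>r \<in> I \<rightarrow>\<^sub>E UNIV.
      (\<forall>i\<in>I. p i \<le> q i + r i) \<longrightarrow> F p \<le> F q + F r)"

lemma vanishes_only_at_zero_iff:
  "vanishes_only_at_zero I F \<longleftrightarrow>
    F (\<lambda>i\<in>I. 0) = 0 \<and> (\<forall>x \<in> I \<rightarrow>\<^sub>E UNIV. F x = 0 \<longrightarrow> (\<forall>i\<in>I. x i = 0))"
proof -
  have "x = (\<lambda>i\<in>I. 0) \<longleftrightarrow> (\<forall>i\<in>I. x i = 0)" if "x \<in> I \<rightarrow>\<^sub>E UNIV" for x :: "'a \<Rightarrow> ennreal"
    using that by (auto simp: fun_eq_iff PiE_iff extensional_def)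
  moreover have "(\<lambda>i\<in>I. 0) \<in> I \<rightarrow>\<^sub>E (UNIV :: ennreal set)" by simp
  ultimately show ?thesis unfolding vanishes_only_at_zero_def by blast
qed

text \<open>Taking \<open>r = 0\<close> yields isotonicity, since then \<open>F r = 0\<close>;
  taking \<open>p = q + r\<close> yields subadditivity. Conversely, both combine through the sum
  \<open>q + r\<close>.\<close>

lemma triangular_on_power_iff:
  assumes "F (\<lambda>i\<in>I. 0) = 0"
  shows "triangular_on_power I F \<longleftrightarrow> isotone_on_power I F \<and> subadditive_on_power I F"
proof
  assume tri: "triangular_on_power I F"
  have "F x \<le> F y"
    if "x \<in> I \<rightarrow>\<^sub>E UNIV" "y \<in> I \<rightarrow>\<^sub>E UNIV" "\<forall>i\<in>I. x i \<le> y i" for x y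
    using tri[unfolded triangular_on_power_def, rule_format, of x y "\<lambda>i\<in>I. 0"] that assms
    by simp
  then show "isotone_on_power I F \<and> subadditive_on_power I F"
    using tri by (auto simp: isotone_on_power_def subadditive_on_power_def triangular_on_power_def)
next
  assume "isotone_on_power I F \<and> subadditive_on_power I F"
  then have "F p \<le> F (\<lambda>i\<in>I. q i + r i)" "F (\<lambda>i\<in>I. q i + r i) \<le> F q + F r"
    if "p \<in> I \<rightarrow>\<^sub>E UNIV" "q \<in> I \<rightarrow>\<^sub>E UNIV" "r \<in> I \<rightarrow>\<^sub>E UNIV" "\<forall>i\<in>I. p i \<le> q i + r i" for p q r
    using that by (auto simp: isotone_on_power_def subadditive_on_power_def)
  then show "triangular_on_power I F"
    unfolding triangular_on_power_def by (meson order_trans)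
qed

section \<open>Triangular functions preserve enriched categories\<close>

text \<open>The order of \<open>P_plus\<close> is reversed, so the unit law forces zero
  self-distance and composition becomes the triangle inequality in each coordinate.\<close>

lemma vcategory_power_P_plus_iff:
  "vcategory (quantale_power P_plus I) X a \<longleftrightarrow>
    X \<noteq> {} \<and> (\<forall>x\<in>X. \<forall>y\<in>X. a x y \<in> I \<rightarrow>\<^sub>E UNIV) \<and> (\<forall>x\<in>X. \<forall>i\<in>I. a x x i = 0) \<and>
    (\<forall>x\<in>X. \<forall>y\<in>X. \<forall>z\<in>X. \<forall>i\<in>I. a x y i \<le> a x z i + a z y i)"
  by (simp add: vcategory_def)

lemma vcategory_P_plus_iff:
  "vcategory P_plus X a \<longleftrightarrow>
    X \<noteq> {} \<and> (\<forall>x\<in>X. a x x = 0) \<and> (\<forall>x\<in>X. \<forall>y\<in>X. \<forall>z\<in>X. a x y \<le> a x z + a z y)"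
  by (simp add: vcategory_def)

lemma triangular_preserves_vcategory:
  assumes tri: "triangular_on_power I F" and F0: "F (\<lambda>i\<in>I. 0) = 0"
    and cat: "vcategory (quantale_power P_plus I) X a"
  shows "vcategory P_plus X (\<lambda>x y. F (a x y))"
proof -
  \<comment> \<open>Extensionality turns coordinatewise vanishing into equality with the zero
    family, where the value of \<open>F\<close> is known.\<close>
  have "a x x = (\<lambda>i\<in>I. 0)" if "x \<in> X" for x
    using cat that
    by (auto simp: vcategory_power_P_plus_iff fun_eq_iff PiE_iff extensional_def)
  then show ?thesis
    using cat tri F0 unfolding vcategory_power_P_plus_iff vcategory_P_plus_iff triangular_on_power_def
    by simp
qed

lemma triangular_preserves_separated_vcategory:
  assumes tri: "triangular_on_power I F" and van: "vanishes_only_at_zero I F"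
    and cat: "separated_vcategory (quantale_power P_plus I) X a"
  shows "separated_vcategory P_plus X (\<lambda>x y. F (a x y))"
proof -
  have "vcategory P_plus X (\<lambda>x y. F (a x y))"
    using van cat unfolding vanishes_only_at_zero_iff separated_vcategory_def
    by (intro triangular_preserves_vcategory[OF tri]) simp_all
  then show ?thesis
    using van cat
    by (simp add: vanishes_only_at_zero_iff separated_vcategory_def vcategory_power_P_plus_iff)
qed

section \<open>Test categories with two or three points\<close>

text \<open>All three backward distances are infinite, so among distinct points only
  \<open>p \<le> q + r\<close> is a real constraint. They also separate the points once there is a
  coordinate; over the empty index set all distances coincide and nothing is separated.\<close>

lemma asymmetric_triangle_vcategory:
  fixes a b c :: 'x and p q r :: "'i \<Rightarrow> ennreal"
  assumes neq: "a \<noteq> b" "b \<noteq> c" "a \<noteq> c"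
    and car: "p \<in> I \<rightarrow>\<^sub>E UNIV" "q \<in> I \<rightarrow>\<^sub>E UNIV" "r \<in> I \<rightarrow>\<^sub>E UNIV"
    and le: "\<forall>i\<in>I. p i \<le> q i + r i"
  obtains d where "vcategory (quantale_power P_plus I) {a, b, c} d"
    and "I \<noteq> {} \<Longrightarrow> separated_vcategory (quantale_power P_plus I) {a, b, c} d"
    and "d a b = q" "d b c = r" "d a c = p"
proof -
  define d where "d = (\<lambda>x y. if x = y then \<lambda>i\<in>I. 0 else if (x, y) = (a, b) then q
    else if (x, y) = (b, c) then r else if (x, y) = (a, c) then p else (\<lambda>i\<in>I. \<infinity>))"
  have cat: "vcategory (quantale_power P_plus I) {a, b, c} d"
    unfolding vcategory_power_P_plus_iff
    using neq neq[symmetric] car le by (simp add: d_def infinity_ennreal_def)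
  moreover have "separated_vcategory (quantale_power P_plus I) {a, b, c} d" if "I \<noteq> {}"
    using cat neq neq[symmetric] that by (auto simp: separated_vcategory_def d_def)
  ultimately show thesis using that[of d] neq by (simp add: d_def)
qed

lemma preserving_imp_triangular:
  assumes "F \<in> preserving_maps TYPE('b::infinite) (quantale_power P_plus I) P_plus"
  shows "triangular_on_power I F"
  unfolding triangular_on_power_def
proof (intro ballI impI)
  fix p q r :: "'a \<Rightarrow> ennreal"
  assume car: "p \<in> I \<rightarrow>\<^sub>E UNIV" "q \<in> I \<rightarrow>\<^sub>E UNIV" "r \<in> I \<rightarrow>\<^sub>E UNIV" and le: "\<forall>i\<in>I. p i \<le> q i + r i"
  obtain a b c :: 'b where neq: "a \<noteq> b" "b \<noteq> c" "a \<noteq> c"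
    by (rule infinite_type_three_points)
  obtain d where "vcategory (quantale_power P_plus I) {a, b, c} d"
    and d: "d a b = q" "d b c = r" "d a c = p"
    using asymmetric_triangle_vcategory[OF neq car le] by blast
  then have "vcategory P_plus {a, b, c} (\<lambda>x y. F (d x y))"
    using assms by (auto simp: preserving_maps_def)
  then have "F (d a c) \<le> F (d a b) + F (d b c)"
    unfolding vcategory_P_plus_iff by blast
  then show "F p \<le> F q + F r" by (simp add: d)
qed

lemma separately_preserving_imp_zero:
  assumes "F \<in> separately_preserving_maps TYPE('b) (quantale_power P_plus I) P_plus"
  shows "F (\<lambda>i\<in>I. 0) = 0"
proof -
  have "separated_vcategory (quantale_power P_plus I) {undefined :: 'b} (\<lambda>_ _. \<lambda>i\<in>I. 0)"
    by (simp add: separated_vcategory_def vcategory_power_P_plus_iff)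
  then have "separated_vcategory P_plus {undefined :: 'b} (\<lambda>_ _. F (\<lambda>i\<in>I. 0))"
    using assms unfolding separately_preserving_maps_def by blast
  then show ?thesis
    by (simp add: separated_vcategory_def vcategory_P_plus_iff)
qed

lemma separately_preserving_imp_triangular:
  assumes F: "F \<in> separately_preserving_maps TYPE('b::infinite) (quantale_power P_plus I) P_plus"
  shows "triangular_on_power I F"
  unfolding triangular_on_power_def
proof (intro ballI impI)
  fix p q r :: "'a \<Rightarrow> ennreal"
  assume car: "p \<in> I \<rightarrow>\<^sub>E UNIV" "q \<in> I \<rightarrow>\<^sub>E UNIV" "r \<in> I \<rightarrow>\<^sub>E UNIV" and le: "\<forall>i\<in>I. p i \<le> q i + r i"
  show "F p \<le> F q + F r"
  proof (cases "I = {}")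
    case True
    \<comment> \<open>The carrier has a single element, so \<open>p\<close>, \<open>q\<close> and
      \<open>r\<close> coincide.\<close>
    then show ?thesis using car by simp
  next
    case False
    obtain a b c :: 'b where neq: "a \<noteq> b" "b \<noteq> c" "a \<noteq> c"
      by (rule infinite_type_three_points)
    obtain d where "separated_vcategory (quantale_power P_plus I) {a, b, c} d"
      and d: "d a b = q" "d b c = r" "d a c = p"
      using asymmetric_triangle_vcategory[OF neq car le] False by metis
    then have "separated_vcategory P_plus {a, b, c} (\<lambda>x y. F (d x y))"
      using F by (auto simp: separately_preserving_maps_def)
    then have "F (d a c) \<le> F (d a b) + F (d b c)"
      unfolding separated_vcategory_def vcategory_P_plus_iff by blast
    then show ?thesis by (simp add: d)
  qed
qed

text \<open>Two points at distance \<open>x\<close> in both directions are separated as soon as some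
  coordinate of \<open>x\<close> is nonzero; with \<open>F x = 0\<close> their image would not
  be.\<close>

lemma separately_preserving_imp_vanishes_only_at_zero:
  assumes F: "F \<in> separately_preserving_maps TYPE('b::infinite) (quantale_power P_plus I) P_plus"
  shows "vanishes_only_at_zero I F"
  unfolding vanishes_only_at_zero_iff
proof (intro conjI ballI impI)
  show "F (\<lambda>i\<in>I. 0) = 0" by (rule separately_preserving_imp_zero[OF F])
next
  fix x i assume x: "x \<in> I \<rightarrow>\<^sub>E UNIV" and Fx: "F x = 0" and i: "i \<in> I"
  obtain a b :: 'b where neq: "a \<noteq> b" by (rule infinite_type_two_points)
  define d where "d = (\<lambda>u v :: 'b. if u = v then \<lambda>i\<in>I. 0 else x)"
  show "x i = 0"
  proof (rule ccontr)
    assume "x i \<noteq> 0"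
    then have "separated_vcategory (quantale_power P_plus I) {a, b} d"
      using x i neq
      by (auto simp: separated_vcategory_def vcategory_power_P_plus_iff d_def)
    then have "separated_vcategory P_plus {a, b} (\<lambda>u v. F (d u v))"
      using F by (auto simp: separately_preserving_maps_def)
    then show False
      using neq Fx by (auto simp: separated_vcategory_def d_def)
  qed
qed

text \<open>In a symmetric triangle all three inequalities must hold, so arbitrary
  \<open>p \<le> q + r\<close> cannot be realised. Sides \<open>x\<close>, \<open>y\<close> and
  \<open>x + y\<close> can, and they give subadditivity.\<close>

lemma symmetrically_preserving_imp_subadditive:
  assumes F: "F \<in> symmetrically_preserving_maps TYPE('b::infinite) (quantale_power P_plus I) P_plus"
  shows "subadditive_on_power I F"
  unfolding subadditive_on_power_def
proof (intro ballI)
  fix x y :: "'a \<Rightarrow> ennreal"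
  assume car: "x \<in> I \<rightarrow>\<^sub>E UNIV" "y \<in> I \<rightarrow>\<^sub>E UNIV"
  obtain a b c :: 'b where neq: "a \<noteq> b" "b \<noteq> c" "a \<noteq> c"
    by (rule infinite_type_three_points)
  define d where "d = (\<lambda>u v. if u = v then \<lambda>i\<in>I. 0 else if {u, v} = {a, b} then x
    else if {u, v} = {b, c} then y else (\<lambda>i\<in>I. x i + y i))"
  have d: "d u u = (\<lambda>i\<in>I. 0)" "d a b = x" "d b a = x" "d b c = y" "d c b = y"
    "d a c = (\<lambda>i\<in>I. x i + y i)" "d c a = (\<lambda>i\<in>I. x i + y i)" for u
    using neq by (auto simp: d_def doubleton_eq_iff)
  have le: "s \<le> s + t + t" "s \<le> t + (s + t)" "t \<le> s + (s + t)" "t \<le> s + t + s" "s + t \<le> t + s"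
    for s t :: ennreal
    by (simp_all add: add_increasing add_increasing2 add.commute)
  have "symmetric_vcategory (quantale_power P_plus I) {a, b, c} d"
    unfolding symmetric_vcategory_def vcategory_power_P_plus_iff
    using car by (simp add: d le)
  then have "symmetric_vcategory P_plus {a, b, c} (\<lambda>u v. F (d u v))"
    using F by (auto simp: symmetrically_preserving_maps_def)
  then have "F (d a c) \<le> F (d a b) + F (d b c)"
    unfolding symmetric_vcategory_def vcategory_P_plus_iff by blast
  then show "F (\<lambda>i\<in>I. x i + y i) \<le> F x + F y"
    by (simp add: d)
qed

section \<open>Triangular functions aggregate modulars\<close>

lemma triangular_imp_quasi_metric_modular_product:
  assumes tri: "triangular_on_power I F" and van: "vanishes_only_at_zero I F"
    and mod: "\<And>i. i \<in> I \<Longrightarrow> quasi_metric_modular (X i) (w i)"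
  shows "quasi_metric_modular (\<Pi>\<^sub>E i\<in>I. X i) (product_modular I F w)"
  unfolding quasi_metric_modular_def
proof (intro conjI ballI allI impI)
  show "(\<Pi>\<^sub>E i\<in>I. X i) \<noteq> {}"
    using mod by (auto simp: PiE_eq_empty_iff quasi_metric_modular_def)
next
  fix t :: real and x assume "0 < t" "x \<in> (\<Pi>\<^sub>E i\<in>I. X i)"
  then have "(\<lambda>i\<in>I. w i t (x i) (x i)) = (\<lambda>i\<in>I. 0)"
    using mod by (intro restrict_ext) (auto simp: quasi_metric_modular_def PiE_iff)
  then show "product_modular I F w t x x = 0"
    using van by (simp add: product_modular_def vanishes_only_at_zero_iff)
next
  fix t s :: real and x y z
  assume "0 < t" "0 < s" "x \<in> (\<Pi>\<^sub>E i\<in>I. X i)" "y \<in> (\<Pi>\<^sub>E i\<in>I. X i)" "z \<in> (\<Pi>\<^sub>E i\<in>I. X i)"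
  then have "\<forall>i\<in>I. w i (t + s) (x i) (y i) \<le> w i t (x i) (z i) + w i s (z i) (y i)"
    using mod by (auto simp: quasi_metric_modular_def PiE_iff)
  then show "product_modular I F w (t + s) x y \<le>
      product_modular I F w t x z + product_modular I F w s z y"
    using tri by (simp add: product_modular_def triangular_on_power_def)
next
  fix x y assume x: "x \<in> (\<Pi>\<^sub>E i\<in>I. X i)" and y: "y \<in> (\<Pi>\<^sub>E i\<in>I. X i)"
  \<comment> \<open>This reduces vanishing of the product modular to vanishing in each coordinate;
    exchanging the quantifiers over \<open>t\<close> and \<open>i\<close> then lets the factors
    separate the points one coordinate at a time.\<close>
  have F_iff: "F (\<lambda>i\<in>I. h i) = 0 \<longleftrightarrow> (\<forall>i\<in>I. h i = 0)" for h
    using van by (auto simp: vanishes_only_at_zero_iff cong: restrict_cong)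
  have "(\<forall>t>0. w i t (x i) (y i) = 0 \<and> w i t (y i) (x i) = 0) \<longleftrightarrow> x i = y i" if "i \<in> I" for i
    using mod[OF that] x y that by (simp add: quasi_metric_modular_def PiE_iff)
  then show "(\<forall>t>0. product_modular I F w t x y = 0 \<and> product_modular I F w t y x = 0)
      \<longleftrightarrow> x = y"
    unfolding product_modular_def F_iff
    using PiE_ext[OF x y] by blast
qed

section \<open>Test modulars with a threshold time\<close>

text \<open>The value \<open>v\<close> is taken at the single time \<open>c\<close>, so monotonicity
  in \<open>t\<close> holds whatever \<open>v\<close> is.\<close>

definition threshold :: "real \<Rightarrow> ennreal \<Rightarrow> real \<Rightarrow> ennreal" where
  "threshold c v t = (if t < c then \<infinity> else if t = c then v else 0)"

text \<open>The long side has threshold 2, the sum of the two short thresholds. Hence the inequality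
  for the long side depends on \<open>p\<close>, \<open>q\<close>, \<open>r\<close> only at
  \<open>t = s = 1\<close>, where it reads \<open>p \<le> q + r\<close>.\<close>

lemma triangle_metric_modular:
  fixes a b c :: 'x
  assumes neq: "a \<noteq> b" "b \<noteq> c" "a \<noteq> c" and le: "p \<le> q + r"
  shows "metric_modular {a, b, c} (\<lambda>t x y. if x = y then 0 else if {x, y} = {a, b} then threshold 1 q t
    else if {x, y} = {b, c} then threshold 1 r t else threshold 2 p t)"
    (is "metric_modular _ ?w")
proof -
  \<comment> \<open>This serves the degenerate case in which the intermediate point is one of the
    endpoints.\<close>
  have mono: "threshold k v (t + s) \<le> threshold k v t" "threshold k v (t + s) \<le> threshold k v s"
    if "0 < t" "0 < s" for k v t s
    using that by (auto simp: threshold_def)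
  \<comment> \<open>If the long leg is finite, its time is at least 2, so the total time exceeds 1
    and the short side is already zero.\<close>
  have short: "threshold 1 v (t + s) \<le> threshold 2 u t + e"
    "threshold 1 v (t + s) \<le> e + threshold 2 u s" if "0 < t" "0 < s" for u v e t s
    using that by (auto simp: threshold_def)
  \<comment> \<open>If \<open>t + s < 2\<close>, some leg is before its threshold and infinite; if
    \<open>t + s > 2\<close>, the left side is zero. At equality either \<open>t = s = 1\<close> or
    one leg is infinite.\<close>
  have long: "threshold 2 p (t + s) \<le> threshold 1 q t + threshold 1 r s"
    "threshold 2 p (t + s) \<le> threshold 1 r t + threshold 1 q s" for t s
    using le by (auto simp: threshold_def add.commute)
  have sep: "\<exists>t>0. threshold k v t \<noteq> 0" if "0 < k" for k v
    \<comment> \<open>Half the threshold is a positive time at which the value is infinite.\<close>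
    using that by (intro exI[of _ "k / 2"]) (auto simp: threshold_def)
  have "?w (t + s) x y \<le> ?w t x z + ?w s z y"
    if "0 < t" "0 < s" "x \<in> {a, b, c}" "y \<in> {a, b, c}" "z \<in> {a, b, c}" for t s x y z
    using that(3-5) neq neq[symmetric] mono[OF that(1,2)] short[OF that(1,2)] long[of t s]
    by (auto simp: doubleton_eq_iff)
  moreover have "(\<forall>t>0. ?w t x y = 0 \<and> ?w t y x = 0) \<longleftrightarrow> x = y" for x y
  proof (cases "x = y")
    case False
    then have "\<exists>t>0. ?w t x y \<noteq> 0"
      using sep[of 1 q] sep[of 1 r] sep[of 2 p]
      by (cases "{x, y} = {a, b}"; cases "{x, y} = {b, c}") simp_all
    then show ?thesis using False by blast
  qed simp
  moreover have "?w t x y = ?w t y x" for t x y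
    by (auto simp: insert_commute)
  ultimately show ?thesis
    unfolding metric_modular_def quasi_metric_modular_def
    by (intro conjI allI ballI impI) (assumption | simp)+
qed

text \<open>The alternative \<open>a = b\<close> admits a one-point factor, needed for coordinates
  whose intended distance is zero.\<close>

lemma discrete_metric_modular:
  assumes "x \<noteq> 0 \<or> a = b"
  shows "metric_modular {a, b} (\<lambda>t u v. if u = v then 0 else x)"
  using assms gt_ex[of "0 :: real"]
  by (auto simp: metric_modular_def quasi_metric_modular_def)

text \<open>The hypothesis takes metric modulars as input and asks only for a quasi-metric modular
  as output. Both aggregation conditions imply it, so one argument serves both.\<close>

lemma metric_modular_products_imp_triangular:
  assumes agg: "\<And>(X :: 'i \<Rightarrow> 'x::infinite set) w. (\<And>i. i \<in> I \<Longrightarrow> metric_modular (X i) (w i)) \<Longrightarrow>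
    quasi_metric_modular (\<Pi>\<^sub>E i\<in>I. X i) (product_modular I F w)"
  shows "triangular_on_power I F"
  unfolding triangular_on_power_def
proof (intro ballI impI)
  fix p q r :: "'i \<Rightarrow> ennreal"
  assume car: "p \<in> I \<rightarrow>\<^sub>E UNIV" "q \<in> I \<rightarrow>\<^sub>E UNIV" "r \<in> I \<rightarrow>\<^sub>E UNIV" and le: "\<forall>i\<in>I. p i \<le> q i + r i"
  obtain a b c :: 'x where neq: "a \<noteq> b" "b \<noteq> c" "a \<noteq> c"
    by (rule infinite_type_three_points)
  define w where "w = (\<lambda>i t x y. if x = y then 0 else if {x, y} = {a, b} then threshold 1 (q i) t
    else if {x, y} = {b, c} then threshold 1 (r i) t else threshold 2 (p i) t)"
  have "metric_modular {a, b, c} (w i)" if "i \<in> I" for i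
    unfolding w_def using triangle_metric_modular[OF neq] le that by blast
  then have mod: "quasi_metric_modular (\<Pi>\<^sub>E i\<in>I. {a, b, c}) (product_modular I F w)"
    by (rule agg)
  \<comment> \<open>At these times every threshold is hit exactly: the legs show \<open>q\<close>
    and \<open>r\<close>, and the long side at time 2 shows \<open>p\<close>.\<close>
  have "product_modular I F w (1 + 1) (\<lambda>i\<in>I. a) (\<lambda>i\<in>I. c) \<le>
      product_modular I F w 1 (\<lambda>i\<in>I. a) (\<lambda>i\<in>I. b) + product_modular I F w 1 (\<lambda>i\<in>I. b) (\<lambda>i\<in>I. c)"
    using mod[unfolded quasi_metric_modular_def, THEN conjunct2, THEN conjunct2, THEN conjunct1,
        rule_format, of 1 1 "\<lambda>i\<in>I. a" "\<lambda>i\<in>I. c" "\<lambda>i\<in>I. b"]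
    by (simp add: PiE_iff del: one_add_one)
  moreover have "(\<lambda>i\<in>I. w i 2 a c) = p" "(\<lambda>i\<in>I. w i 1 a b) = q" "(\<lambda>i\<in>I. w i 1 b c) = r"
    using car neq by (auto simp: w_def threshold_def doubleton_eq_iff fun_eq_iff PiE_iff extensional_def)
  ultimately show "F p \<le> F q + F r"
    by (simp add: product_modular_def cong: restrict_cong)
qed

text \<open>In a product of discrete modulars, two points are placed so that their distance is
  constantly \<open>F x\<close> and they coincide exactly when \<open>x\<close> is zero. The
  separation axiom, an equivalence, gives both directions at once.\<close>

lemma metric_modular_products_imp_vanishes_only_at_zero:
  assumes agg: "\<And>(X :: 'i \<Rightarrow> 'x::infinite set) w. (\<And>i. i \<in> I \<Longrightarrow> metric_modular (X i) (w i)) \<Longrightarrow>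
    quasi_metric_modular (\<Pi>\<^sub>E i\<in>I. X i) (product_modular I F w)"
  shows "vanishes_only_at_zero I F"
proof -
  obtain a b :: 'x where neq: "a \<noteq> b" by (rule infinite_type_two_points)
  have F_iff: "F x = 0 \<longleftrightarrow> (\<forall>i\<in>I. x i = 0)" if x: "x \<in> I \<rightarrow>\<^sub>E UNIV" for x
  proof -
    \<comment> \<open>Where \<open>x\<close> vanishes the factor must collapse to one point to be separated.\<close>
    define e where "e i = (if x i = 0 then a else b)" for i
    define w where "w = (\<lambda>i (t :: real) (u :: 'x) v. if u = v then 0 else x i)"
    have "metric_modular {a, e i} (w i)" for i
      unfolding w_def by (rule discrete_metric_modular) (simp add: e_def)
    then have "quasi_metric_modular (\<Pi>\<^sub>E i\<in>I. {a, e i}) (product_modular I F w)"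
      by (rule agg)
    then have "(\<forall>t>0. product_modular I F w t (\<lambda>i\<in>I. a) (\<lambda>i\<in>I. e i) = 0 \<and>
        product_modular I F w t (\<lambda>i\<in>I. e i) (\<lambda>i\<in>I. a) = 0) \<longleftrightarrow> (\<lambda>i\<in>I. a) = (\<lambda>i\<in>I. e i)"
      by (simp add: quasi_metric_modular_def PiE_iff)
    \<comment> \<open>The distance between \<open>a\<close> and \<open>e i\<close> is
      \<open>x i\<close> in either case: the points coincide precisely when
      \<open>x i = 0\<close>.\<close>
    moreover have "product_modular I F w t (\<lambda>i\<in>I. a) (\<lambda>i\<in>I. e i) = F x"
      "product_modular I F w t (\<lambda>i\<in>I. e i) (\<lambda>i\<in>I. a) = F x" for t
      using x neq unfolding product_modular_def
      by (auto intro!: arg_cong[of _ _ F] simp: w_def e_def fun_eq_iff PiE_iff extensional_def)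
    moreover have "(\<lambda>i\<in>I. a) = (\<lambda>i\<in>I. e i) \<longleftrightarrow> (\<forall>i\<in>I. x i = 0)"
      using neq by (auto simp: e_def fun_eq_iff)
    ultimately show ?thesis
      using gt_ex[of "0 :: real"] by simp
  qed
  then show ?thesis by (simp add: vanishes_only_at_zero_iff)
qed

section \<open>Reduction of the six conditions to the triangle condition\<close>

theorem theorem8p5:
  fixes I :: "'i set" and F :: "('i \<Rightarrow> ennreal) \<Rightarrow> ennreal"
  shows "all_equivalent
    [F \<in> separately_preserving_maps TYPE('a::infinite) (quantale_power P_plus I) P_plus,
     F \<in> preserving_maps TYPE('b::infinite) (quantale_power P_plus I) P_plus \<and>
       vanishes_only_at_zero I F,
     F \<in> symmetrically_preserving_maps TYPE('c::infinite) (quantale_power P_plus I) P_plus \<and>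
       isotone_on_power I F \<and> vanishes_only_at_zero I F,
     metric_modular_aggregation TYPE('d::infinite) I F,
     isotone_on_power I F \<and> subadditive_on_power I F \<and> vanishes_only_at_zero I F,
     quasi_metric_modular_aggregation TYPE('e::infinite) I F]"
proof -
  \<comment> \<open>This condition mentions no ambient type, so statements over five unrelated types
    can each be compared with it.\<close>
  let ?T = "triangular_on_power I F \<and> vanishes_only_at_zero I F"
  let ?V = "quantale_power P_plus I"
  have se: "F \<in> separately_preserving_maps TYPE('a) ?V P_plus \<longleftrightarrow> ?T"
    using separately_preserving_imp_triangular separately_preserving_imp_vanishes_only_at_zero
      triangular_preserves_separated_vcategory[of I F]
    by (auto simp: separately_preserving_maps_def)
  have "F \<in> preserving_maps TYPE('b) ?V P_plus" if ?T
    using triangular_preserves_vcategory[of I F] that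
    by (auto simp: preserving_maps_def vanishes_only_at_zero_iff)
  then have pr: "F \<in> preserving_maps TYPE('b) ?V P_plus \<and> vanishes_only_at_zero I F \<longleftrightarrow> ?T"
    by (auto dest: preserving_imp_triangular)
  have tri: "isotone_on_power I F \<and> subadditive_on_power I F \<and> vanishes_only_at_zero I F \<longleftrightarrow> ?T"
    using triangular_on_power_iff by (auto simp: vanishes_only_at_zero_iff)
  have sy: "F \<in> symmetrically_preserving_maps TYPE('c) ?V P_plus \<and> isotone_on_power I F \<and>
      vanishes_only_at_zero I F \<longleftrightarrow> ?T" (is "?S \<longleftrightarrow> _")
  proof
    assume ?S
    then show ?T using symmetrically_preserving_imp_subadditive tri by blast
  next
    assume T: ?T
    then have "symmetric_vcategory P_plus X (\<lambda>x y. F (a x y))"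
      if "symmetric_vcategory ?V X a" for X :: "'c set" and a
      using triangular_preserves_vcategory that
      by (auto simp: symmetric_vcategory_def vanishes_only_at_zero_iff)
    then show ?S using T tri by (auto simp: symmetrically_preserving_maps_def)
  qed
  have me: "metric_modular_aggregation TYPE('d) I F \<longleftrightarrow> ?T"
  proof
    assume "metric_modular_aggregation TYPE('d) I F"
    then have "quasi_metric_modular (\<Pi>\<^sub>E i\<in>I. X i) (product_modular I F w)"
      if "\<And>i. i \<in> I \<Longrightarrow> metric_modular (X i) (w i)" for X :: "'i \<Rightarrow> 'd set" and w
      using that by (simp add: metric_modular_aggregation_def metric_modular_def)
    then show ?T
      using metric_modular_products_imp_triangular
        metric_modular_products_imp_vanishes_only_at_zero by blast
  next
    assume T: ?T
    show "metric_modular_aggregation TYPE('d) I F"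
      unfolding metric_modular_aggregation_def
    proof (intro allI impI)
      fix X :: "'i \<Rightarrow> 'd set" and w
      assume mod: "\<forall>i\<in>I. metric_modular (X i) (w i)"
      then have "quasi_metric_modular (\<Pi>\<^sub>E i\<in>I. X i) (product_modular I F w)"
        using T by (intro triangular_imp_quasi_metric_modular_product) (auto simp: metric_modular_def)
      \<comment> \<open>Symmetry of the factors makes the two arguments of \<open>F\<close> the same
        family.\<close>
      moreover have "product_modular I F w t x y = product_modular I F w t y x"
        if "0 < t" "x \<in> (\<Pi>\<^sub>E i\<in>I. X i)" "y \<in> (\<Pi>\<^sub>E i\<in>I. X i)" for t x y
        using mod that unfolding product_modular_def
        by (intro arg_cong[of _ _ F] restrict_ext) (auto simp: metric_modular_def PiE_iff)
      ultimately show "metric_modular (\<Pi>\<^sub>E i\<in>I. X i) (product_modular I F w)"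
        by (simp add: metric_modular_def)
    qed
  qed
  have qu: "quasi_metric_modular_aggregation TYPE('e) I F \<longleftrightarrow> ?T"
  proof
    assume "quasi_metric_modular_aggregation TYPE('e) I F"
    \<comment> \<open>The aggregation property is tested on symmetric factors only, which are
      quasi-metric modulars in particular.\<close>
    then have "quasi_metric_modular (\<Pi>\<^sub>E i\<in>I. X i) (product_modular I F w)"
      if "\<And>i. i \<in> I \<Longrightarrow> metric_modular (X i) (w i)" for X :: "'i \<Rightarrow> 'e set" and w
      using that by (simp add: quasi_metric_modular_aggregation_def metric_modular_def)
    then show ?T
      using metric_modular_products_imp_triangular
        metric_modular_products_imp_vanishes_only_at_zero by blast
  next
    assume ?T
    then show "quasi_metric_modular_aggregation TYPE('e) I F"
      unfolding quasi_metric_modular_aggregation_def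
      by (auto intro: triangular_imp_quasi_metric_modular_product)
  qed
  show ?thesis
    unfolding all_equivalent_def by (simp add: se pr sy me tri qu)
qed

end
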